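(* Let $\varphi:\Sigma\to\Delta$ be a morphism of finite posets. If there exists a balanced map $m_\Sigma:\Sigma\to\mathbb Z_{\ge1}$ (with respect to $\varphi$), then $\varphi$ is an open map.
   Context: A morphism of posets is an order-preserving map. Posets carry the topology whose open sets are the up-closed sets. We write $\alpha\lessdot\gamma$ if $\gamma$ covers $\alpha$ ($\alpha<\gamma$ with no element strictly between). A map $m_\Sigma:\Sigma\to\mathbb Z_{\ge1}$ is balanced with respect to $\varphi$ if for every $\alpha\in\Sigma$ and every $\beta\in\Delta$ with $\varphi(\alpha)\lessdot\beta$ one has $m_\Sigma(\alpha)=\sum_{\gamma\in\varphi^{-1}(\beta),\ \alpha\lessdot\gamma}m_\Sigma(\gamma)$, where empty sums are $0$. *)

theory Defs
  imports "HOL-Analysis.Abstract_Topology"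
begin

text \<open>
  A poset is a pair of a carrier \<open>A\<close> and a relation \<open>r\<close> with \<^term>\<open>partial_order_on A r\<close>;
  \<open>(x, y) \<in> r\<close> reads \<open>x \<le> y\<close>.
\<close>

definition poset_morphism ::
    "'a set \<Rightarrow> 'a rel \<Rightarrow> 'b set \<Rightarrow> 'b rel \<Rightarrow> ('a \<Rightarrow> 'b) \<Rightarrow> bool" where
  "poset_morphism A r B s f \<longleftrightarrow>
     f \<in> A \<rightarrow> B \<and> monotone_on A (\<lambda>x y. (x, y) \<in> r) (\<lambda>x y. (x, y) \<in> s) f"

definition up_closed :: "'a set \<Rightarrow> 'a rel \<Rightarrow> 'a set \<Rightarrow> bool" where
  "up_closed A r U \<longleftrightarrow> U \<subseteq> A \<and> (\<forall>x\<in>U. \<forall>y\<in>A. (x, y) \<in> r \<longrightarrow> y \<in> U)"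

definition poset_topology :: "'a set \<Rightarrow> 'a rel \<Rightarrow> 'a topology" where
  "poset_topology A r = topology (up_closed A r)"

lemma istopology_up_closed: "istopology (up_closed A r)"
  unfolding istopology_def up_closed_def by blast

lemma openin_poset_topology: "openin (poset_topology A r) = up_closed A r"
  by (simp add: poset_topology_def topology_inverse' istopology_up_closed)

lemma topspace_poset_topology: "topspace (poset_topology A r) = A"
  unfolding topspace_def openin_poset_topology by (auto simp: up_closed_def)

definition covered_by :: "'a set \<Rightarrow> 'a rel \<Rightarrow> 'a \<Rightarrow> 'a \<Rightarrow> bool" where
  "covered_by A r x y \<longleftrightarrow>
     x \<in> A \<and> y \<in> A \<and> (x, y) \<in> r \<and> x \<noteq> y \<and>
     \<not> (\<exists>z\<in>A. (x, z) \<in> r \<and> z \<noteq> x \<and> (z, y) \<in> r \<and> z \<noteq> y)"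

definition balanced ::
    "'a set \<Rightarrow> 'a rel \<Rightarrow> 'b set \<Rightarrow> 'b rel \<Rightarrow> ('a \<Rightarrow> 'b) \<Rightarrow> ('a \<Rightarrow> int) \<Rightarrow> bool" where
  "balanced A r B s f m \<longleftrightarrow>
     (\<forall>x\<in>A. \<forall>b\<in>B. covered_by B s (f x) b \<longrightarrow>
        m x = (\<Sum>y | y \<in> A \<and> f y = b \<and> covered_by A r x y. m y))"

end

theory Submission
  imports Defs
begin

text \<open>
  A map between posets is open as soon as it lifts comparabilities: whenever \<open>\<phi> \<alpha> \<le> \<beta>\<close>, some
  \<open>\<gamma> \<ge> \<alpha>\<close> lies over \<open>\<beta>\<close>. In a finite poset, \<open>\<phi> \<alpha> \<le> \<beta>\<close> is witnessed by a chain of covering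
  relations, so it is enough to lift a single one \<open>\<phi> \<alpha> \<lessdot> \<beta>\<close> and climb (lemma
  \<open>lift_of_lift_cover\<close>). The balancing condition supplies that lift: \<open>m \<alpha>\<close> is the sum of \<open>m\<close> over
  the possible lifts, and it is positive, so the sum cannot be empty (lemma
  \<open>balanced_lift_cover\<close>).
\<close>

lemma ex_covered_by_below:
  assumes "finite B" "partial_order_on B s"
    and "a \<in> B" "b \<in> B" "(a, b) \<in> s" "a \<noteq> b"
  obtains c where "covered_by B s a c" "(c, b) \<in> s"
proof -
  have "trans s" and "antisym s" and refl: "(b, b) \<in> s"
    using assms(2,4) by (auto simp: partial_order_on_def preorder_on_def refl_on_def)
  note trans = transD[OF \<open>trans s\<close>] and antisym = antisymD[OF \<open>antisym s\<close>]
  \<comment> \<open>A minimal element of the half-open interval from \<open>a\<close> to \<open>b\<close> covers \<open>a\<close>.\<close>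
  define I where "I = {z \<in> B. (a, z) \<in> s \<and> z \<noteq> a \<and> (z, b) \<in> s}"
  define lt where "lt = (\<lambda>x y. (x, y) \<in> s \<and> x \<noteq> y)"
  have "finite I" "I \<noteq> {}"
    using assms refl by (auto simp: I_def)
  moreover have "asymp_on I lt"
    by (auto simp: lt_def intro!: asymp_onI dest: antisym)
  moreover have "transp_on I lt"
    unfolding lt_def by (intro transp_onI) (blast dest: trans antisym)
  ultimately obtain c where c: "c \<in> I" and min: "\<forall>z\<in>I. z \<noteq> c \<longrightarrow> \<not> lt z c"
    using Finite_Set.bex_min_element[of I lt] by blast
  have "covered_by B s a c"
    using c min \<open>a \<in> B\<close> unfolding covered_by_def I_def lt_def by (blast dest: trans)
  with c show thesis
    by (intro that) (auto simp: I_def)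
qed

lemma lift_of_lift_cover:
  assumes "finite B" and B: "partial_order_on B s"
    and A: "partial_order_on A r" and f: "f \<in> A \<rightarrow> B"
    and lift: "\<And>x c. x \<in> A \<Longrightarrow> covered_by B s (f x) c \<Longrightarrow> \<exists>y\<in>A. (x, y) \<in> r \<and> f y = c"
    and "x \<in> A" "b \<in> B" "(f x, b) \<in> s"
  shows "\<exists>y\<in>A. (x, y) \<in> r \<and> f y = b"
  using assms(6,8)
  \<comment> \<open>Each lifted cover moves \<open>f x\<close> strictly closer to \<open>b\<close>, shrinking the interval between them.\<close>
proof (induction "card {z \<in> B. (f x, z) \<in> s \<and> (z, b) \<in> s}" arbitrary: x rule: less_induct)
  case less
  have transA: "trans r" and transB: "trans s" and antisym: "antisym s"
    and reflA: "(x, x) \<in> r" and reflB: "(f x, f x) \<in> s"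
    using A B f \<open>x \<in> A\<close> by (auto simp: partial_order_on_def preorder_on_def refl_on_def)
  show ?case
  proof (cases "f x = b")
    case True
    with reflA less.prems show ?thesis by blast
  next
    case False
    have "f x \<in> B" using f less.prems by blast
    then obtain c where c: "covered_by B s (f x) c" "(c, b) \<in> s"
      using ex_covered_by_below[OF \<open>finite B\<close> B _ \<open>b \<in> B\<close> less.prems(2) False] by blast
    then obtain y where y: "y \<in> A" "(x, y) \<in> r" "f y = c"
      using lift less.prems by blast
    have c': "(f x, c) \<in> s" "c \<noteq> f x"
      using c by (auto simp: covered_by_def)
    have "{z \<in> B. (c, z) \<in> s \<and> (z, b) \<in> s} \<subseteq> {z \<in> B. (f x, z) \<in> s \<and> (z, b) \<in> s}"
      using c' transD[OF transB] by blast
    moreover have "f x \<in> {z \<in> B. (f x, z) \<in> s \<and> (z, b) \<in> s}"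
      using \<open>f x \<in> B\<close> reflB less.prems by blast
    moreover have "f x \<notin> {z \<in> B. (c, z) \<in> s \<and> (z, b) \<in> s}"
      using c' antisymD[OF antisym] by blast
    ultimately have "{z \<in> B. (c, z) \<in> s \<and> (z, b) \<in> s} \<subset> {z \<in> B. (f x, z) \<in> s \<and> (z, b) \<in> s}"
      by blast
    then have "card {z \<in> B. (f y, z) \<in> s \<and> (z, b) \<in> s} < card {z \<in> B. (f x, z) \<in> s \<and> (z, b) \<in> s}"
      using \<open>finite B\<close> y(3) by (intro psubset_card_mono) auto
    then obtain w where "w \<in> A" "(y, w) \<in> r" "f w = b"
      using less.hyps y c by blast
    with y transD[OF transA] show ?thesis by blast
  qed
qed

lemma balanced_lift_cover:
  assumes "m \<in> A \<rightarrow> {1..}" "balanced A r B s f m"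
    and "x \<in> A" "covered_by B s (f x) b"
  shows "\<exists>y\<in>A. (x, y) \<in> r \<and> f y = b"
proof -
  let ?Y = "{y. y \<in> A \<and> f y = b \<and> covered_by A r x y}"
  have "m x = sum m ?Y"
    using assms by (auto simp: balanced_def covered_by_def)
  moreover have "m x \<ge> 1" using assms by auto
  ultimately have "?Y \<noteq> {}" by (metis not_one_le_zero sum.empty)
  then show ?thesis by (auto simp: covered_by_def)
qed

lemma open_map_poset_topology_if_lift:
  assumes "f \<in> A \<rightarrow> B"
    and lift: "\<And>x b. x \<in> A \<Longrightarrow> b \<in> B \<Longrightarrow> (f x, b) \<in> s \<Longrightarrow> \<exists>y\<in>A. (x, y) \<in> r \<and> f y = b"
  shows "open_map (poset_topology A r) (poset_topology B s) f"
  unfolding open_map_def openin_poset_topology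
proof (intro allI impI)
  fix U assume U: "up_closed A r U"
  have "b \<in> f ` U" if "x \<in> U" "b \<in> B" "(f x, b) \<in> s" for x b
    using lift[of x b] that U unfolding up_closed_def by blast
  then show "up_closed B s (f ` U)"
    using U assms(1) unfolding up_closed_def by blast
qed

theorem mainTheorem3:
  fixes \<Sigma> :: "'a set" and r :: "'a rel"
    and \<Delta> :: "'b set" and s :: "'b rel"
    and \<phi> :: "'a \<Rightarrow> 'b"
  assumes "finite \<Sigma>" and "partial_order_on \<Sigma> r"
    and "finite \<Delta>" and "partial_order_on \<Delta> s"
    and "poset_morphism \<Sigma> r \<Delta> s \<phi>"
    and "\<exists>m :: 'a \<Rightarrow> int. m \<in> \<Sigma> \<rightarrow> {1..} \<and> balanced \<Sigma> r \<Delta> s \<phi> m"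
  shows "open_map (poset_topology \<Sigma> r) (poset_topology \<Delta> s) \<phi>"
proof -
  obtain m :: "'a \<Rightarrow> int" where m: "m \<in> \<Sigma> \<rightarrow> {1..}" "balanced \<Sigma> r \<Delta> s \<phi> m"
    using assms(6) by blast
  have \<phi>: "\<phi> \<in> \<Sigma> \<rightarrow> \<Delta>"
    using assms(5) by (simp add: poset_morphism_def)
  show ?thesis
    using lift_of_lift_cover[OF assms(3,4,2) \<phi> balanced_lift_cover[OF m]]
    by (intro open_map_poset_topology_if_lift[OF \<phi>]) blast
qed

end
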